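(* Let $(X_0,Y_0)\in PPS$ be strongly efficient, with $X_0=(x_{10},\dots,x_{m0})^T$ and $Y_0=(y_{10},\dots,y_{s0})^T$ having strictly positive components. Let $\omega_i\ge 0$ ($i=1,\dots,m$) with $\sum_{i=1}^m\omega_i=m$ and $\delta_r\ge 0$ ($r=1,\dots,s$) with $\sum_{r=1}^s\delta_r=s$ be fixed. For $t>0$ let $\xi^*(t)$ be the optimal value of $$\max_{\beta,\lambda_j}\ \beta/t\quad\text{s.t.}\quad \sum_{j=1}^n\lambda_jx_{ij}\le(1+\omega_it)x_{i0}\ (i=1,\dots,m),\quad \sum_{j=1}^n\lambda_jy_{rj}\ge(1+\delta_r\beta)y_{r0}\ (r=1,\dots,s),\quad \sum_{j=1}^n\lambda_j=1,\ \lambda_j\ge0,\ \beta\in\mathbb{R}.$$ Then there exists $t_0^+>0$ such that $\xi^*(t)$ is constant for $t\in(0,t_0^+]$.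
   Context: Data: input vectors $X_j=(x_{1j},\dots,x_{mj})^T\in\mathbb{R}^m$ and output vectors $Y_j=(y_{1j},\dots,y_{sj})^T\in\mathbb{R}^s$ with nonnegative components, $j=1,\dots,n$. The production possibility set (variable returns to scale) is $$PPS=\Big\{(X,Y)\in\mathbb{R}^m\times\mathbb{R}^s:\ X\ge\sum_{j=1}^n\lambda_jX_j,\ Y\le\sum_{j=1}^n\lambda_jY_j,\ \sum_{j=1}^n\lambda_j=1,\ \lambda_j\ge0\Big\},$$ with componentwise inequalities. A point $(X,Y)\in PPS$ is strongly efficient if there is no $(\bar X,\bar Y)\in PPS$ with $(-\bar X,\bar Y)\ge(-X,Y)$ and $(\bar X,\bar Y)\ne(X,Y)$. *)

theory Defs
  imports "HOL-Analysis.Analysis"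
begin

text \<open>
  The \<open>n\<close> observed units, the \<open>m\<close> inputs and the \<open>s\<close> outputs are indexed by the finite types
  \<open>'n\<close>, \<open>'m\<close>, \<open>'s\<close>. On \<open>real ^ 'k\<close>, and on pairs of such vectors, \<open>\<le>\<close> is the componentwise order.
\<close>

definition pps ::
  "('n::finite \<Rightarrow> real ^ 'm::finite) \<Rightarrow> ('n \<Rightarrow> real ^ 's::finite) \<Rightarrow> ((real ^ 'm) \<times> (real ^ 's)) set"
  where
  "pps x y = {(X, Y). \<exists>l :: 'n \<Rightarrow> real.
      (\<Sum>j\<in>UNIV. l j *\<^sub>R x j) \<le> X \<and> Y \<le> (\<Sum>j\<in>UNIV. l j *\<^sub>R y j) \<and>
      (\<Sum>j\<in>UNIV. l j) = 1 \<and> (\<forall>j. 0 \<le> l j)}"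

definition strongly_efficient ::
  "('n::finite \<Rightarrow> real ^ 'm::finite) \<Rightarrow> ('n \<Rightarrow> real ^ 's::finite) \<Rightarrow> real ^ 'm \<Rightarrow> real ^ 's \<Rightarrow> bool"
  where
  "strongly_efficient x y X Y \<longleftrightarrow> (X, Y) \<in> pps x y \<and>
     \<not> (\<exists>X' Y'. (X', Y') \<in> pps x y \<and> (- X, Y) \<le> (- X', Y') \<and> (X', Y') \<noteq> (X, Y))"

definition feasible ::
  "('n::finite \<Rightarrow> real ^ 'm::finite) \<Rightarrow> ('n \<Rightarrow> real ^ 's::finite) \<Rightarrow> real ^ 'm \<Rightarrow> real ^ 's \<Rightarrow>
   ('m \<Rightarrow> real) \<Rightarrow> ('s \<Rightarrow> real) \<Rightarrow> real \<Rightarrow> real \<Rightarrow> ('n \<Rightarrow> real) \<Rightarrow> bool"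
  where
  "feasible x y X0 Y0 \<omega> \<delta> t \<beta> l \<longleftrightarrow>
     (\<forall>i. (\<Sum>j\<in>UNIV. l j * x j $ i) \<le> (1 + \<omega> i * t) * X0 $ i) \<and>
     (\<forall>r. (\<Sum>j\<in>UNIV. l j * y j $ r) \<ge> (1 + \<delta> r * \<beta>) * Y0 $ r) \<and>
     (\<Sum>j\<in>UNIV. l j) = 1 \<and> (\<forall>j. 0 \<le> l j)"

definition is_optimal_value ::
  "('n::finite \<Rightarrow> real ^ 'm::finite) \<Rightarrow> ('n \<Rightarrow> real ^ 's::finite) \<Rightarrow> real ^ 'm \<Rightarrow> real ^ 's \<Rightarrow>
   ('m \<Rightarrow> real) \<Rightarrow> ('s \<Rightarrow> real) \<Rightarrow> real \<Rightarrow> real \<Rightarrow> bool"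
  where
  "is_optimal_value x y X0 Y0 \<omega> \<delta> t v \<longleftrightarrow>
     (\<exists>\<beta> l. feasible x y X0 Y0 \<omega> \<delta> t \<beta> l \<and> v = \<beta> / t) \<and>
     (\<forall>\<beta> l. feasible x y X0 Y0 \<omega> \<delta> t \<beta> l \<longrightarrow> \<beta> / t \<le> v)"

text \<open>
  A maximum is unique if it exists. If it does not exist, the value below is unspecified, so
  statements about it should also assert \<open>is_optimal_value\<close>.
\<close>

definition xi_star ::
  "('n::finite \<Rightarrow> real ^ 'm::finite) \<Rightarrow> ('n \<Rightarrow> real ^ 's::finite) \<Rightarrow> real ^ 'm \<Rightarrow> real ^ 's \<Rightarrow>
   ('m \<Rightarrow> real) \<Rightarrow> ('s \<Rightarrow> real) \<Rightarrow> real \<Rightarrow> real"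
  where
  "xi_star x y X0 Y0 \<omega> \<delta> t = (THE v. is_optimal_value x y X0 Y0 \<omega> \<delta> t v)"

end

theory Submission
  imports Defs
begin

text \<open>
  Let \<open>\<beta>\<^sup>*(t)\<close> be the largest feasible \<open>\<beta>\<close> for the parameter \<open>t\<close>, so that \<open>\<xi>\<^sup>*(t) = \<beta>\<^sup>*(t) / t\<close>.
  Treat \<open>t\<close> as a further variable. The triples \<open>(t, \<beta>, \<lambda>)\<close> with \<open>0 \<le> t \<le> 1\<close>, \<open>\<beta> \<ge> 0\<close> and
  \<open>(\<beta>, \<lambda>)\<close> feasible for \<open>t\<close> form a polytope (\<open>polytope_program\<close>), because the constraints are jointly
  linear in the three variables, \<open>\<lambda>\<close> ranges over a simplex, and an output with positive
  direction bounds \<open>\<beta>\<close> from above. Strong efficiency of \<open>(X\<^sub>0, Y\<^sub>0)\<close> says that \<open>t = 0\<close> forces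
  \<open>\<beta> \<le> 0\<close> (\<open>feasible_at_0_nonpos\<close>).

  A polytope is the convex hull of finitely many vertices. If \<open>c\<close> is the largest ratio
  \<open>\<beta> / t\<close> among the vertices with \<open>t > 0\<close>, then the half-space \<open>\<beta> \<le> c t\<close> contains these vertices
  by the choice of \<open>c\<close>, and the remaining ones because \<open>\<beta> \<le> 0\<close> there; hence it contains
  the polytope (\<open>polytope_ratio_attains_max\<close>). So the ratio \<open>\<beta> / t\<close> has a maximum although \<open>t\<close> may
  vanish. Let a maximizing vertex have \<open>t = t\<^sub>0\<close>. The segment that joins it to a
  feasible triple \<open>(0, 0, \<lambda>\<^sub>0)\<close> stays in the polytope and its points have ratio \<open>c\<close>, so the bound
  \<open>\<beta>\<^sup>*(t) \<le> c t\<close> is attained for all \<open>t \<in> (0, t\<^sub>0]\<close>.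
\<close>

section \<open>Maximizing a ratio over a polytope\<close>

text \<open>
  The denominator may vanish on \<open>P\<close>, so compactness alone does not give a maximum: it can fail on a
  disc that touches the line \<open>a = 0\<close> in a point with \<open>b = 0\<close>. Finitely many vertices suffice to
  bound the ratio, which is why \<open>P\<close> has to be a polytope. The inequality is multiplied out to
  cover the points with \<open>a = 0\<close>.
\<close>

lemma polytope_ratio_attains_max:
  fixes P :: "'a::euclidean_space set" and a b :: "'a \<Rightarrow> real"
  assumes P: "polytope P" and a: "linear a" and b: "linear b"
    and nonneg: "\<And>p. p \<in> P \<Longrightarrow> 0 \<le> a p"
    and zero: "\<And>p. p \<in> P \<Longrightarrow> a p = 0 \<Longrightarrow> b p \<le> 0"
    and pos: "\<exists>p\<in>P. 0 < a p"
  obtains p where "p \<in> P" "0 < a p" "\<And>q. q \<in> P \<Longrightarrow> b q \<le> b p / a p * a q"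
proof -
  obtain V where V: "finite V" "P = convex hull V"
    using P unfolding polytope_def by blast
  have VP: "V \<subseteq> P"
    unfolding V(2) by (rule hull_subset)
  have half: "P \<subseteq> {q. f q \<le> 0}" if "linear f" "\<And>v. v \<in> V \<Longrightarrow> f v \<le> 0" for f :: "'a \<Rightarrow> real"
  proof -
    have "convex (f -` {..0})"
      using that(1) by (intro convex_linear_vimage) auto
    then have "convex hull V \<subseteq> f -` {..0}"
      using that(2) by (intro hull_minimal) auto
    then show ?thesis unfolding V(2) by auto
  qed
  define W where "W = {v \<in> V. 0 < a v}"
  have "W \<noteq> {}"
  proof
    assume "W = {}"
    then have "a v \<le> 0" if "v \<in> V" for v using that unfolding W_def by auto
    then have "P \<subseteq> {q. a q \<le> 0}" by (rule half[OF a])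
    with pos show False by auto
  qed
  moreover have "finite W" using V unfolding W_def by auto
  ultimately have "Max ((\<lambda>v. b v / a v) ` W) \<in> (\<lambda>v. b v / a v) ` W"
    by (intro Max_in) auto
  then obtain p where p: "p \<in> W" and Max: "Max ((\<lambda>v. b v / a v) ` W) = b p / a p"
    by auto
  have p_max: "b v / a v \<le> b p / a p" if "v \<in> W" for v
    unfolding Max[symmetric] using \<open>finite W\<close> that by (intro Max_ge) auto
  define c where "c = b p / a p"
  have "linear (\<lambda>q. b q - c * a q)"
    using a b linear_compose_scale_right[OF a, of c] by (auto intro: linear_compose_sub)
  moreover have "b v - c * a v \<le> 0" if "v \<in> V" for v
  proof (cases "a v = 0")
    case True
    then show ?thesis using zero VP that by auto
  next
    case False
    then have "0 < a v" using nonneg VP that by force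
    then show ?thesis
      using p_max[of v] that unfolding W_def c_def by (simp add: pos_divide_le_eq)
  qed
  ultimately have "P \<subseteq> {q. b q - c * a q \<le> 0}" by (rule half)
  then have "b q \<le> c * a q" if "q \<in> P" for q
    using that by auto
  then show thesis
    using that[of p] p VP unfolding W_def c_def by auto
qed

section \<open>The program with the parameter as a variable\<close>

text \<open>The constraint \<open>\<beta> \<ge> 0\<close> makes the set bounded. It loses no optimal point, because \<open>\<beta> = 0\<close> is
  feasible for every \<open>t \<ge> 0\<close> (\<open>feasible_beta_0\<close>).\<close>

definition program ::
  "('n::finite \<Rightarrow> real ^ 'm::finite) \<Rightarrow> ('n \<Rightarrow> real ^ 's::finite) \<Rightarrow> real ^ 'm \<Rightarrow> real ^ 's \<Rightarrow>
   ('m \<Rightarrow> real) \<Rightarrow> ('s \<Rightarrow> real) \<Rightarrow> real \<Rightarrow> (real \<times> real \<times> (real ^ 'n)) set"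
  where
  "program x y X0 Y0 \<omega> \<delta> T = {(t, \<beta>, l). 0 \<le> t \<and> t \<le> T \<and> 0 \<le> \<beta> \<and>
     feasible x y X0 Y0 \<omega> \<delta> t \<beta> (($) l)}"

lemma vec_lambda_mem_program_iff:
  "(t, \<beta>, vec_lambda l) \<in> program x y X0 Y0 \<omega> \<delta> T \<longleftrightarrow>
     0 \<le> t \<and> t \<le> T \<and> 0 \<le> \<beta> \<and> feasible x y X0 Y0 \<omega> \<delta> t \<beta> l"
proof -
  have "($) (vec_lambda l) = l" by (rule ext) simp
  then show ?thesis unfolding program_def by simp
qed

lemma polyhedron_program:
  fixes x :: "'n::finite \<Rightarrow> real ^ 'm::finite" and y :: "'n \<Rightarrow> real ^ 's::finite"
  shows "polyhedron (program x y X0 Y0 \<omega> \<delta> T)"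
proof -
  let ?input = "\<lambda>i. {p. (- (\<omega> i * X0 $ i), 0, \<chi> j. x j $ i) \<bullet> p \<le> X0 $ i}"
  let ?output = "\<lambda>r. {p. (0, \<delta> r * Y0 $ r, \<chi> j. - (y j $ r)) \<bullet> p \<le> - (Y0 $ r)}"
  let ?weight = "\<lambda>j. {p. (0, 0, axis j (-1)) \<bullet> p \<le> (0::real)}"
  let ?H = "{{p. (1, 0, 0) \<bullet> p \<ge> 0}, {p. (1, 0, 0) \<bullet> p \<le> T}, {p. (0, 1, 0) \<bullet> p \<ge> 0},
      {p. (0, 0, 1) \<bullet> p = 1}} \<union> range ?input \<union> range ?output \<union> range ?weight
      :: (real \<times> real \<times> (real ^ 'n)) set set"
  have "p \<in> \<Inter>?H \<longleftrightarrow> p \<in> program x y X0 Y0 \<omega> \<delta> T" for p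
  proof -
    obtain t \<beta> l where p: "p = (t, \<beta>, l)" by (cases p)
    have "(- (\<omega> i * X0 $ i), 0, \<chi> j. x j $ i) \<bullet> p \<le> X0 $ i \<longleftrightarrow>
        (\<Sum>j\<in>UNIV. l $ j * x j $ i) \<le> (1 + \<omega> i * t) * X0 $ i" for i
      by (simp add: p inner_vec_def algebra_simps)
    moreover have "(0, \<delta> r * Y0 $ r, \<chi> j. - (y j $ r)) \<bullet> p \<le> - (Y0 $ r) \<longleftrightarrow>
        (1 + \<delta> r * \<beta>) * Y0 $ r \<le> (\<Sum>j\<in>UNIV. l $ j * y j $ r)" for r
      by (simp add: p inner_vec_def sum_negf algebra_simps)
    moreover have "(0, 0, axis j (-1)) \<bullet> p \<le> 0 \<longleftrightarrow> 0 \<le> l $ j" for j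
      by (simp add: p inner_axis')
    moreover have "(0, 0, 1) \<bullet> p = (\<Sum>j\<in>UNIV. l $ j)"
      by (simp add: p inner_vec_def)
    moreover have "(1, 0, 0) \<bullet> p = t" "(0, 1, 0) \<bullet> p = \<beta>"
      by (simp_all add: p)
    moreover have "p \<in> program x y X0 Y0 \<omega> \<delta> T \<longleftrightarrow>
        0 \<le> t \<and> t \<le> T \<and> 0 \<le> \<beta> \<and> feasible x y X0 Y0 \<omega> \<delta> t \<beta> (($) l)"
      by (simp add: p program_def)
    ultimately show ?thesis
      unfolding feasible_def Inter_Un_distrib Int_iff Inter_insert Inter_empty INT_iff mem_Collect_eq
      by (simp add: conj_ac)
  qed
  then have "\<Inter>?H = program x y X0 Y0 \<omega> \<delta> T" by (intro set_eqI)
  moreover have "polyhedron (\<Inter>?H)"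
  proof (rule polyhedron_Inter)
    fix S assume "S \<in> ?H"
    then show "polyhedron S"
      by (elim UnE insertE emptyE imageE)
        (simp_all only: polyhedron_halfspace_le polyhedron_halfspace_ge polyhedron_hyperplane)
  qed simp
  ultimately show ?thesis by (simp only:)
qed

text \<open>Boundedness comes from the outputs: they are at most \<open>\<Sum>\<^sub>j y\<^sub>r\<^sub>j\<close>, and an output \<open>r\<close> with
  \<open>\<delta>\<^sub>r Y\<^sub>0\<^sub>r > 0\<close> has to grow with \<open>\<beta>\<close>.\<close>

lemma polytope_program:
  assumes y: "\<And>j r. 0 \<le> y j $ r" and r: "0 < \<delta> r" "0 < Y0 $ r"
  shows "polytope (program x y X0 Y0 \<omega> \<delta> T)"
proof -
  define B where "B = (\<Sum>j\<in>UNIV. y j $ r) / (\<delta> r * Y0 $ r)"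
  have "p \<in> cbox (0, 0, 0) (T, B, 1)" if "p \<in> program x y X0 Y0 \<omega> \<delta> T" for p
  proof -
    obtain t \<beta> l where p: "p = (t, \<beta>, l)" by (cases p)
    have t: "0 \<le> t" "t \<le> T" "0 \<le> \<beta>" and l: "\<And>j. 0 \<le> l $ j" "(\<Sum>j\<in>UNIV. l $ j) = 1"
      and out: "(1 + \<delta> r * \<beta>) * Y0 $ r \<le> (\<Sum>j\<in>UNIV. l $ j * y j $ r)"
      using that unfolding p program_def feasible_def by auto
    have l1: "l $ j \<le> 1" for j
      using member_le_sum[of j UNIV "($) l"] l by simp
    have "(\<Sum>j\<in>UNIV. l $ j * y j $ r) \<le> (\<Sum>j\<in>UNIV. y j $ r)"
      by (intro sum_mono mult_left_le_one_le y l l1)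
    with out r have "\<beta> * (\<delta> r * Y0 $ r) \<le> (\<Sum>j\<in>UNIV. y j $ r)"
      by (simp add: algebra_simps)
    then have "\<beta> \<le> B"
      using r unfolding B_def by (simp add: pos_le_divide_eq)
    then show ?thesis
      using t l(1) l1 unfolding p by (simp add: cbox_Pair_eq mem_box_cart)
  qed
  then have "bounded (program x y X0 Y0 \<omega> \<delta> T)"
    using bounded_subset[OF bounded_cbox] by blast
  then show ?thesis
    using polyhedron_program polytope_eq_bounded_polyhedron by blast
qed

section \<open>Feasible and optimal points\<close>

lemma feasible_beta_0:
  assumes "(X0, Y0) \<in> pps x y" "\<And>i. 0 \<le> X0 $ i" "\<And>i. 0 \<le> \<omega> i"
  obtains l where "\<And>t. 0 \<le> t \<Longrightarrow> feasible x y X0 Y0 \<omega> \<delta> t 0 l"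
proof -
  obtain l where l: "(\<Sum>j\<in>UNIV. l j *\<^sub>R x j) \<le> X0" "Y0 \<le> (\<Sum>j\<in>UNIV. l j *\<^sub>R y j)"
     "(\<Sum>j\<in>UNIV. l j) = 1" "\<forall>j. 0 \<le> l j"
    using assms(1) unfolding pps_def by auto
  have "feasible x y X0 Y0 \<omega> \<delta> t 0 l" if "0 \<le> t" for t
  proof -
    have "(\<Sum>j\<in>UNIV. l j * x j $ i) \<le> (1 + \<omega> i * t) * X0 $ i" for i
    proof -
      have "(\<Sum>j\<in>UNIV. l j * x j $ i) \<le> X0 $ i"
        using l(1) by (simp add: less_eq_vec_def)
      also have "\<dots> \<le> (1 + \<omega> i * t) * X0 $ i"
        using assms(2,3) that by (simp add: algebra_simps)
      finally show ?thesis .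
    qed
    then show ?thesis
      using l unfolding feasible_def by (simp add: less_eq_vec_def)
  qed
  then show thesis using that by blast
qed

text \<open>With \<open>t = 0\<close> and \<open>\<beta> > 0\<close> the point \<open>(\<Sum>\<^sub>j \<lambda>\<^sub>j X\<^sub>j, \<Sum>\<^sub>j \<lambda>\<^sub>j Y\<^sub>j)\<close> would dominate \<open>(X\<^sub>0, Y\<^sub>0)\<close>,
  strictly so in the output \<open>r\<close>.\<close>

lemma feasible_at_0_nonpos:
  assumes eff: "strongly_efficient x y X0 Y0"
    and Y0: "\<And>r. 0 \<le> Y0 $ r" and \<delta>: "\<And>r. 0 \<le> \<delta> r" and r: "0 < \<delta> r" "0 < Y0 $ r"
    and feas: "feasible x y X0 Y0 \<omega> \<delta> 0 \<beta> l"
  shows "\<beta> \<le> 0"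
proof (rule ccontr)
  assume "\<not> \<beta> \<le> 0"
  then have \<beta>: "0 < \<beta>" by simp
  let ?X = "\<Sum>j\<in>UNIV. l j *\<^sub>R x j" and ?Y = "\<Sum>j\<in>UNIV. l j *\<^sub>R y j"
  have out: "Y0 $ k + \<delta> k * \<beta> * Y0 $ k \<le> ?Y $ k" for k
    using feas unfolding feasible_def by (simp add: algebra_simps)
  have "Y0 $ k \<le> ?Y $ k" for k
  proof -
    have "0 \<le> \<delta> k * \<beta> * Y0 $ k" using \<delta> Y0 \<beta> by simp
    then show ?thesis using out[of k] by linarith
  qed
  then have "Y0 \<le> ?Y" unfolding less_eq_vec_def by blast
  moreover have "?X \<le> X0"
    using feas unfolding feasible_def less_eq_vec_def by simp
  ultimately have "(- X0, Y0) \<le> (- ?X, ?Y)"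
    by (simp add: less_eq_vec_def)
  moreover have "(?X, ?Y) \<in> pps x y"
    using feas unfolding feasible_def pps_def by auto
  moreover have "?Y \<noteq> Y0"
  proof -
    have "0 < \<delta> r * \<beta> * Y0 $ r" using r \<beta> by simp
    then show ?thesis using out[of r] by auto
  qed
  ultimately show False
    using eff unfolding strongly_efficient_def by blast
qed

lemma xi_star_eq:
  assumes "is_optimal_value x y X0 Y0 \<omega> \<delta> t v"
  shows "xi_star x y X0 Y0 \<omega> \<delta> t = v"
  unfolding xi_star_def
proof (rule the_equality[where P = "is_optimal_value x y X0 Y0 \<omega> \<delta> t", OF assms])
  fix w assume "is_optimal_value x y X0 Y0 \<omega> \<delta> t w"
  then show "w = v"
    using assms unfolding is_optimal_value_def by (metis order.antisym)
qed

text \<open>The slice of the program over a single \<open>t > 0\<close> is compact, and \<open>\<beta>\<close> is continuous on it.\<close>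

lemma ex_optimal_value:
  assumes cpt: "compact (program x y X0 Y0 \<omega> \<delta> t)" and "0 < t"
    and l0: "feasible x y X0 Y0 \<omega> \<delta> t 0 l0"
  shows "\<exists>v. is_optimal_value x y X0 Y0 \<omega> \<delta> t v"
proof -
  let ?S = "program x y X0 Y0 \<omega> \<delta> t \<inter> fst -` {t}"
  have "compact ?S"
    using cpt by (intro compact_Int_closed closed_vimage_fst) auto
  moreover have l0_mem: "(t, 0, vec_lambda l0) \<in> ?S"
    using l0 \<open>0 < t\<close> by (simp add: vec_lambda_mem_program_iff)
  moreover have "continuous_on ?S (\<lambda>p. fst (snd p))"
    by (intro continuous_intros)
  ultimately obtain p where p: "p \<in> ?S" "\<And>q. q \<in> ?S \<Longrightarrow> fst (snd q) \<le> fst (snd p)"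
    using continuous_attains_sup[of ?S "\<lambda>p. fst (snd p)"] by blast
  obtain \<beta> l where \<beta>: "p = (t, \<beta>, l)" using p(1) by (cases p) auto
  have "\<beta>' \<le> \<beta>" if "feasible x y X0 Y0 \<omega> \<delta> t \<beta>' l'" for \<beta>' l'
  proof (cases "0 \<le> \<beta>'")
    case True
    then show ?thesis
      using p(2)[of "(t, \<beta>', vec_lambda l')"] that \<open>0 < t\<close>
      by (simp add: \<beta> vec_lambda_mem_program_iff)
  next
    case False
    then show ?thesis using p(2)[OF l0_mem] by (simp add: \<beta>)
  qed
  moreover have "feasible x y X0 Y0 \<omega> \<delta> t \<beta> (($) l)"
    using p(1) unfolding \<beta> program_def by auto
  ultimately have "is_optimal_value x y X0 Y0 \<omega> \<delta> t (\<beta> / t)"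
    unfolding is_optimal_value_def using \<open>0 < t\<close> by (auto intro: divide_right_mono)
  then show ?thesis by blast
qed

section \<open>Constancy near the origin\<close>

theorem theorem2:
  fixes x :: "'n::finite \<Rightarrow> real ^ 'm::finite"
    and y :: "'n \<Rightarrow> real ^ 's::finite"
    and X0 :: "real ^ 'm" and Y0 :: "real ^ 's"
    and \<omega> :: "'m \<Rightarrow> real" and \<delta> :: "'s \<Rightarrow> real"
  assumes "\<And>j i. 0 \<le> x j $ i" and "\<And>j r. 0 \<le> y j $ r"
    and "strongly_efficient x y X0 Y0"
    and "\<And>i. 0 < X0 $ i" and "\<And>r. 0 < Y0 $ r"
    and "\<And>i. 0 \<le> \<omega> i" and "(\<Sum>i\<in>UNIV. \<omega> i) = real CARD('m)"
    and "\<And>r. 0 \<le> \<delta> r" and "(\<Sum>r\<in>UNIV. \<delta> r) = real CARD('s)"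
  shows "(\<forall>t>0. is_optimal_value x y X0 Y0 \<omega> \<delta> t (xi_star x y X0 Y0 \<omega> \<delta> t)) \<and>
         (\<exists>t0>0. \<exists>c. \<forall>t\<in>{0<..t0}. xi_star x y X0 Y0 \<omega> \<delta> t = c)"
proof -
  let ?feas = "feasible x y X0 Y0 \<omega> \<delta>" and ?P = "program x y X0 Y0 \<omega> \<delta>"
  obtain r where r: "0 < \<delta> r"
  proof -
    have "(\<Sum>r\<in>UNIV. \<delta> r) \<noteq> 0" using assms(9) by simp
    then obtain r where "\<delta> r \<noteq> 0" using sum.neutral[of UNIV \<delta>] by blast
    then show thesis using that[of r] assms(8)[of r] by simp
  qed
  have poly: "polytope (?P T)" for T
    by (intro polytope_program[where r = r] assms r)
  obtain l0 where l0: "\<And>t. 0 \<le> t \<Longrightarrow> ?feas t 0 l0"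
    using feasible_beta_0[of X0 Y0 x y \<omega> \<delta>] assms(3,4,6)
    unfolding strongly_efficient_def by (metis less_imp_le)
  have l0_mem: "(t, 0, vec_lambda l0) \<in> ?P 1" if "0 \<le> t" "t \<le> 1" for t
    using l0 that by (simp add: vec_lambda_mem_program_iff)
  have optimal: "is_optimal_value x y X0 Y0 \<omega> \<delta> t (xi_star x y X0 Y0 \<omega> \<delta> t)" if "0 < t" for t
    using ex_optimal_value[OF polytope_imp_compact[OF poly] that l0] that xi_star_eq
    by (metis less_imp_le)
  have at_0: "\<beta> \<le> 0" if "?feas 0 \<beta> l" for \<beta> l
    using feasible_at_0_nonpos[OF assms(3) _ assms(8) r assms(5) that] assms(5)
    by (simp add: less_imp_le)
  have zero: "fst (snd p) \<le> 0" if "p \<in> ?P 1" "fst p = 0" for p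
    using that at_0 unfolding program_def by auto
  obtain p where p: "p \<in> ?P 1" "0 < fst p"
    and bound: "\<And>q. q \<in> ?P 1 \<Longrightarrow> fst (snd q) \<le> fst (snd p) / fst p * fst q"
  proof (rule polytope_ratio_attains_max[of "?P 1" fst "\<lambda>p. fst (snd p)"])
    show "linear (fst :: real \<times> real \<times> (real ^ 'n) \<Rightarrow> real)"
      by (rule linear_fst)
    show "linear (\<lambda>p :: real \<times> real \<times> (real ^ 'n). fst (snd p))"
      using linear_compose[OF linear_snd linear_fst] by (simp add: o_def)
    show "\<exists>p\<in>?P 1. 0 < fst p"
      using l0_mem[of 1] by force
  qed (use poly zero in \<open>auto simp: program_def\<close>)
  define t0 where "t0 = fst p"
  define c where "c = fst (snd p) / fst p"
  have t0: "0 < t0" "t0 \<le> 1" and c: "0 \<le> c" and p_eq: "p = (t0, c * t0, snd (snd p))"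
    using p unfolding t0_def c_def program_def by (auto simp: prod_eq_iff)
  have "is_optimal_value x y X0 Y0 \<omega> \<delta> t c" if t: "t \<in> {0<..t0}" for t
  proof -
    have upper: "\<beta> / t \<le> c" if "?feas t \<beta> l" for \<beta> l
    proof (cases "0 \<le> \<beta>")
      case True
      then have "(t, \<beta>, vec_lambda l) \<in> ?P 1"
        using that t t0 by (simp add: vec_lambda_mem_program_iff)
      from bound[OF this] show ?thesis
        using t by (simp add: c_def[symmetric] pos_divide_le_eq)
    next
      case False
      then have "\<beta> / t \<le> 0" using t by (simp add: divide_le_0_iff)
      then show ?thesis using c by linarith
    qed
    \<comment> \<open>The point over \<open>t\<close> on the segment from the origin, lifted by \<open>l0\<close>, to the maximizer.\<close>
    let ?q = "(1 - t / t0) *\<^sub>R (0, 0, vec_lambda l0) + (t / t0) *\<^sub>R p"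
    have "?q \<in> ?P 1"
      using polytope_imp_convex[OF poly] l0_mem[of 0] p(1) t t0
      by (intro convexD) auto
    moreover have "fst ?q = t" "fst (snd ?q) = c * t"
      using t0 by (subst p_eq, simp)+
    ultimately have "?feas t (c * t) (($) (snd (snd ?q)))"
      unfolding program_def by (auto simp: case_prod_beta)
    moreover have "c = c * t / t" using t by simp
    ultimately show ?thesis
      unfolding is_optimal_value_def using upper by blast
  qed
  then have "\<forall>t\<in>{0<..t0}. xi_star x y X0 Y0 \<omega> \<delta> t = c"
    by (intro ballI xi_star_eq)
  with t0(1) optimal show ?thesis
    by (intro conjI allI impI exI)
qed

end
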